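(* Let $\Xi\sim\mathrm{PIP}(\beta,\varphi)$ be a stationary pairwise interaction process on $\mathbb{R}^d$ that is inhibitory and has finite interaction range, with intensity $\lambda$. For $t\ge0$ put $\tilde G_t=\int_{\mathbb{R}^d}\bigl[1-\varphi(x)\mathbf{1}\{\|x\|>t\}\bigr]\,dx$. Then for every $t\ge0$ the nearest neighbour function $G(\cdot)$ of $\Xi$ satisfies $$2-\frac{\beta}{\lambda}-\exp(-\beta\tilde G_t)\;\le\;G(t)\;\le\;1-\frac{\beta}{\lambda}+\beta\tilde G_t .$$
   Context: Let $\mathfrak{N}$ be the space of locally finite point measures on $\mathbb{R}^d$ with the $\sigma$-algebra generated by the evaluation maps $\xi\mapsto\xi(A)$, $A$ bounded Borel. A point process is a random element of $\mathfrak{N}$; all point processes are simple, so configurations are identified with locally finite sets. A point process $\Xi$ on $\mathbb{R}^d$ is a Gibbs process with conditional intensity $\lambda(\cdot\mid\cdot)\colon\mathbb{R}^d\times\mathfrak{N}\to[0,\infty)$ (measurable) if $$\mathbb{E}\Bigl(\int_{\mathbb{R}^d} h(x,\Xi\setminus\{x\})\,\Xi(dx)\Bigr)=\int_{\mathbb{R}^d}\mathbb{E}\bigl(h(x,\Xi)\lambda(x\mid\Xi)\bigr)\,dx$$ for all measurable $h\colon\mathbb{R}^d\times\mathfrak{N}\to[0,\infty)$. $\Xi$ need not be uniquely determined by $\lambda(\cdot\mid\cdot)$; results hold for every such process. $\Xi$ is stationary if its distribution is translation invariant. $\Xi\sim\mathrm{PIP}(\beta,\varphi)$ (stationary pairwise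 interaction process) means that $\Xi$ is a stationary Gibbs process with conditional intensity $\lambda(x\mid\xi)=\beta\prod_{y\in\xi}\varphi(x-y)$, where $\beta>0$ is a constant and $\varphi\colon\mathbb{R}^d\to[0,\infty)$ is a measurable interaction function with $\varphi(-x)=\varphi(x)$. It is inhibitory if $\varphi\le1$ and has finite interaction range if $1-\varphi$ is compactly supported. The intensity of $\Xi$ is the constant $\lambda=\mathbb{E}(\lambda(0\mid\Xi))$, i.e. $\mathbb{E}\,\Xi(A)=\lambda|A|$ for Borel sets $A$. The nearest neighbour function $G(t)$ is the distribution function of the distance from a typical point of $\Xi$ (in the sense of the Palm distribution) to its nearest neighbour: for any Borel set $B$ with $0<|B|<\infty$, $$G(t)=\frac{1}{\lambda|B|}\,\mathbb{E}\sum_{x\in\Xi\cap B}\mathbf{1}\bigl\{\exists\,y\in\Xi\setminus\{x\}\colon\|y-x\|\le t\bigr\}.$$ For $\Xi\sim\mathrm{PIP}(\beta,\varphi)$ this equals $1-\frac{\beta}{\lambda}\mathbb{E}\bigl(\prod_{y\in\Xi}\mathbf{1}\{\|y\|>t\}\varphi(y)\bigr)$. *)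

theory Defs
  imports "HOL-Probability.Probability"
begin

text \<open>Simple point configurations are represented by their sets of points.\<close>

definition configs :: "'a::euclidean_space set set" where
  "configs = {\<xi>. \<forall>A. bounded A \<longrightarrow> finite (\<xi> \<inter> A)}"

text \<open>The counts \<open>card (\<xi> \<inter> A)\<close> of bounded sets are natural numbers, so their level sets
  generate the same sigma-algebra as the evaluation maps.\<close>

definition config_space :: "'a::euclidean_space set measure" where
  "config_space = sigma configs
     {{\<xi> \<in> configs. card (\<xi> \<inter> A) = n} | A n. A \<in> sets borel \<and> bounded A}"

definition point_process :: "'w measure \<Rightarrow> ('w \<Rightarrow> 'a::euclidean_space set) \<Rightarrow> bool" where
  "point_process M \<Xi> \<longleftrightarrow> prob_space M \<and> \<Xi> \<in> measurable M config_space"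

definition stationary :: "'w measure \<Rightarrow> ('w \<Rightarrow> 'a::euclidean_space set) \<Rightarrow> bool" where
  "stationary M \<Xi> \<longleftrightarrow>
     (\<forall>a. distr M config_space (\<lambda>\<omega>. (\<lambda>x. a + x) ` \<Xi> \<omega>) = distr M config_space \<Xi>)"

definition gibbs_process ::
  "'w measure \<Rightarrow> ('w \<Rightarrow> 'a::euclidean_space set) \<Rightarrow> ('a \<Rightarrow> 'a set \<Rightarrow> real) \<Rightarrow> bool" where
  "gibbs_process M \<Xi> ci \<longleftrightarrow>
     point_process M \<Xi> \<and>
     (\<lambda>(x, \<xi>). ci x \<xi>) \<in> borel_measurable (borel \<Otimes>\<^sub>M config_space) \<and>
     (\<forall>x. \<forall>\<xi>\<in>configs. 0 \<le> ci x \<xi>) \<and>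
     (\<forall>h::'a \<times> 'a set \<Rightarrow> real.
        h \<in> borel_measurable (borel \<Otimes>\<^sub>M config_space) \<longrightarrow>
        (\<forall>x. \<forall>\<xi>\<in>configs. 0 \<le> h (x, \<xi>)) \<longrightarrow>
        (\<integral>\<^sup>+ \<omega>. (\<integral>\<^sup>+ x. ennreal (h (x, \<Xi> \<omega> - {x})) \<partial>count_space (\<Xi> \<omega>)) \<partial>M) =
        (\<integral>\<^sup>+ x. (\<integral>\<^sup>+ \<omega>. ennreal (h (x, \<Xi> \<omega>) * ci x (\<Xi> \<omega>)) \<partial>M) \<partial>lborel))"

text \<open>Unordered product over a possibly infinite set, as the limit along the net of finite
  subsets (the multiplicative counterpart of \<^const>\<open>infsum\<close>; the library \<^const>\<open>prod\<close> is
  1 on every infinite set). A zero factor gives the value 0.\<close>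

definition infprod_on :: "('b \<Rightarrow> real) \<Rightarrow> 'b set \<Rightarrow> real" where
  "infprod_on f A = Lim (finite_subsets_at_top A) (prod f)"

definition pip_intensity ::
  "real \<Rightarrow> ('a::euclidean_space \<Rightarrow> real) \<Rightarrow> 'a \<Rightarrow> 'a set \<Rightarrow> real" where
  "pip_intensity \<beta> \<phi> x \<xi> = \<beta> * infprod_on (\<lambda>y. \<phi> (x - y)) \<xi>"

definition PIP ::
  "'w measure \<Rightarrow> ('w \<Rightarrow> 'a::euclidean_space set) \<Rightarrow> real \<Rightarrow> ('a \<Rightarrow> real) \<Rightarrow> bool" where
  "PIP M \<Xi> \<beta> \<phi> \<longleftrightarrow>
     0 < \<beta> \<and> \<phi> \<in> borel_measurable borel \<and> (\<forall>x. 0 \<le> \<phi> x) \<and> (\<forall>x. \<phi> (- x) = \<phi> x) \<and>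
     stationary M \<Xi> \<and> gibbs_process M \<Xi> (pip_intensity \<beta> \<phi>)"

definition inhibitory :: "('a::euclidean_space \<Rightarrow> real) \<Rightarrow> bool" where
  "inhibitory \<phi> \<longleftrightarrow> (\<forall>x. \<phi> x \<le> 1)"

definition finite_range :: "('a::euclidean_space \<Rightarrow> real) \<Rightarrow> bool" where
  "finite_range \<phi> \<longleftrightarrow> compact (closure {x. 1 - \<phi> x \<noteq> 0})"

definition intensity ::
  "'w measure \<Rightarrow> ('w \<Rightarrow> 'a::euclidean_space set) \<Rightarrow> ('a \<Rightarrow> 'a set \<Rightarrow> real) \<Rightarrow> real" where
  "intensity M \<Xi> ci = (\<integral>\<omega>. ci 0 (\<Xi> \<omega>) \<partial>M)"

text \<open>The nearest neighbour function of a process with intensity \<open>l\<close>, evaluated with the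
  reference window \<open>B\<close> from the Campbell formula for the Palm distribution. For stationary
  processes and \<open>0 < |B| < \<infinity>\<close> the value does not depend on \<open>B\<close>, and the expectation is
  at most \<open>l |B|\<close>, so \<^const>\<open>enn2real\<close> loses nothing.\<close>

definition nn_function ::
  "'w measure \<Rightarrow> ('w \<Rightarrow> 'a::euclidean_space set) \<Rightarrow> real \<Rightarrow> 'a set \<Rightarrow> real \<Rightarrow> real" where
  "nn_function M \<Xi> l B t =
     enn2real (\<integral>\<^sup>+ \<omega>. (\<integral>\<^sup>+ x. of_bool (\<exists>y \<in> \<Xi> \<omega> - {x}. norm (y - x) \<le> t)
                         \<partial>count_space (\<Xi> \<omega> \<inter> B)) \<partial>M)
     / (l * measure lborel B)"

definition G_tilde :: "('a::euclidean_space \<Rightarrow> real) \<Rightarrow> real \<Rightarrow> real" where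
  "G_tilde \<phi> t = (\<integral>x. (1 - \<phi> x * of_bool (norm x > t)) \<partial>lborel)"

end

theory Submission
  imports Defs
begin

text \<open>
  By the Gibbs equation and stationarity, the number of points of \<open>\<Xi>\<close> in \<open>B\<close> with a neighbour
  within distance \<open>t\<close> has expectation
  \<open>|B| E[\<lambda>(0|\<Xi>) 1{\<Xi> meets the t-ball}] = |B| (\<lambda> - \<beta> E[\<Prod>y\<in>\<Xi>. 1 - u y])\<close>, where
  \<open>u x = 1 - \<phi> x 1{|x| > t}\<close>. So \<open>G(t) = 1 - (\<beta>/\<lambda>) \<Psi>(1)\<close> for \<open>\<Psi>(s) = E[\<Prod>y\<in>\<Xi>. 1 - s u y]\<close>, and
  the two claims are the bounds \<open>1 - \<lambda> m \<le> \<Psi>(1) \<le> 1 - (\<lambda>/\<beta>) (1 - exp (- \<beta> m))\<close> with \<open>m = \<integral>u\<close>.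

  These hold for every Gibbs process whose conditional intensity is at most \<open>\<beta>\<close>, does not
  increase when points are added, and has mean \<open>\<lambda>\<close> at each location. The lower bound (\<open>Psi_ge\<close>) is Weierstrass'
  inequality \<open>1 \<le> \<Prod>(1 - u y) + \<Sum>u y\<close> in expectation. For the upper bound (\<open>Psi_le\<close>), the Gibbs
  equation gives formally \<open>\<Psi>'(s) = - \<integral>u(x) K x s dx\<close> with
  \<open>K x s = E[\<lambda>(x|\<Xi>) \<Prod>y\<in>\<Xi>. 1 - s u y]\<close>. Applying it once more to \<open>K x\<close>, monotonicity and the bound
  \<open>\<beta>\<close> give \<open>(K x)' \<ge> - \<beta> m K x\<close>, hence \<open>K x s \<ge> \<lambda> exp (- \<beta> m s)\<close>, and integrating yields the claim.

  Instead of differentiating under the expectation, \<open>[0, 1]\<close> is cut into \<open>n\<close> steps. The two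
  derivative formulas become one-step inequalities (\<open>palm_step\<close>, \<open>Psi_step\<close>) that follow from
  comparing two finite products factor by factor, and \<open>n\<close> tends to infinity at the end.
\<close>

section \<open>Finite products\<close>

text \<open>Exchanging the factors \<open>a x\<close> for \<open>b x\<close> one at a time telescopes the difference of the products
  into terms \<open>a x - b x\<close> times a mixture of factors of \<open>a\<close> and \<open>b\<close>. Replacing the mixture by factors
  of \<open>a\<close> alone bounds the difference from above, by factors of \<open>b\<close> alone from below.\<close>

lemma prod_telescope_upper:
  fixes a b :: "'b \<Rightarrow> real"
  assumes "finite S" "\<And>x. x \<in> S \<Longrightarrow> 0 \<le> b x" "\<And>x. x \<in> S \<Longrightarrow> b x \<le> a x"
  shows "prod a S \<le> prod b S + (\<Sum>x\<in>S. (a x - b x) * prod a (S - {x}))"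
  using assms
proof (induction S rule: finite_induct)
  case (insert z S)
  have *: "prod a (insert z S - {x}) = a z * prod a (S - {x})" if "x \<in> S" for x
    using insert.hyps that by (subst insert_Diff_if) auto
  have "b z * prod a S \<le> b z * (prod b S + (\<Sum>x\<in>S. (a x - b x) * prod a (S - {x})))"
    using insert by (intro mult_left_mono) auto
  also have "\<dots> \<le> b z * prod b S + (\<Sum>x\<in>S. (a x - b x) * (a z * prod a (S - {x})))"
    unfolding distrib_left sum_distrib_left
  proof (intro add_left_mono sum_mono)
    fix x assume "x \<in> S"
    have "0 \<le> prod a (S - {x})"
      using insert.prems by (intro prod_nonneg) (meson DiffD1 insertI2 order_trans)
    moreover have "0 \<le> a x - b x" "b z \<le> a z"
      using insert.prems \<open>x \<in> S\<close> by auto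
    ultimately show "b z * ((a x - b x) * prod a (S - {x})) \<le> (a x - b x) * (a z * prod a (S - {x}))"
      by (metis mult.left_commute mult_left_mono mult_nonneg_nonneg mult_right_mono)
  qed
  finally show ?case
    using insert.hyps by (simp add: * algebra_simps)
qed simp

lemma prod_telescope_lower:
  fixes a b :: "'b \<Rightarrow> real"
  assumes "finite S" "\<And>x. x \<in> S \<Longrightarrow> 0 \<le> b x" "\<And>x. x \<in> S \<Longrightarrow> b x \<le> a x"
  shows "prod b S + (\<Sum>x\<in>S. (a x - b x) * prod b (S - {x})) \<le> prod a S"
  using assms
proof (induction S rule: finite_induct)
  case (insert z S)
  have *: "prod b (insert z S - {x}) = b z * prod b (S - {x})" if "x \<in> S" for x
    using insert.hyps that by (subst insert_Diff_if) auto
  have "b z * (prod b S + (\<Sum>x\<in>S. (a x - b x) * prod b (S - {x}))) \<le> b z * prod a S"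
    using insert by (intro mult_left_mono) auto
  moreover have "(a z - b z) * prod b S \<le> (a z - b z) * prod a S"
    using insert.prems by (intro mult_left_mono prod_mono) auto
  moreover have "(\<Sum>x\<in>S. (a x - b x) * prod b (insert z S - {x}))
      = b z * (\<Sum>x\<in>S. (a x - b x) * prod b (S - {x}))"
    unfolding sum_distrib_left by (intro sum.cong refl) (simp add: *)
  ultimately show ?case
    using insert.hyps by (simp add: algebra_simps)
qed simp

lemma infprod_on_eq_prod:
  assumes "finite F" "F \<subseteq> A" "\<And>x. x \<in> A - F \<Longrightarrow> f x = 1"
  shows "infprod_on f A = prod f F"
  unfolding infprod_on_def
proof (rule tendsto_Lim)
  have "\<forall>\<^sub>F X in finite_subsets_at_top A. prod f X = prod f F"
    unfolding eventually_finite_subsets_at_top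
  proof (intro exI conjI allI impI)
    fix Y assume "finite Y \<and> F \<subseteq> Y \<and> Y \<subseteq> A"
    then show "prod f Y = prod f F"
      using assms(3) by (intro prod.mono_neutral_right) auto
  qed (use assms in auto)
  then show "(prod f \<longlongrightarrow> prod f F) (finite_subsets_at_top A)"
    by (rule tendsto_eventually)
qed simp

section \<open>The space of configurations\<close>

lemma space_config_space [simp]: "space config_space = configs"
  by (auto simp: config_space_def intro!: space_measure_of)

lemma finite_config_Int: "\<xi> \<in> configs \<Longrightarrow> bounded A \<Longrightarrow> finite (\<xi> \<inter> A)"
  by (simp add: configs_def)

lemma config_Diff: "\<xi> \<in> configs \<Longrightarrow> \<xi> - S \<in> configs"
  by (auto simp: configs_def Diff_Int_distrib2)

lemma sets_config_count:
  assumes "A \<in> sets borel" "bounded A"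
  shows "{\<xi> \<in> configs. card (\<xi> \<inter> A) = n} \<in> sets config_space"
proof -
  have "sets config_space = sigma_sets configs
     {{\<xi> \<in> configs. card (\<xi> \<inter> A) = n} | A n. (A::'a set) \<in> sets borel \<and> bounded A}"
    unfolding config_space_def by (intro sets_measure_of) auto
  then show ?thesis using assms by (auto intro!: sigma_sets.Basic)
qed

lemma measurable_config_count:
  assumes "A \<in> sets borel" "bounded A"
  shows "(\<lambda>\<xi>. card (\<xi> \<inter> A)) \<in> measurable config_space (count_space UNIV)"
  unfolding measurable_count_space_eq2_countable
proof (intro conjI ballI)
  fix n :: nat
  have "(\<lambda>\<xi>. card (\<xi> \<inter> A)) -` {n} \<inter> space config_space = {\<xi> \<in> configs. card (\<xi> \<inter> A) = n}"
    by auto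
  then show "(\<lambda>\<xi>. card (\<xi> \<inter> A)) -` {n} \<inter> space config_space \<in> sets config_space"
    using sets_config_count[OF assms] by simp
qed simp

text \<open>For a simple function the product over a configuration is a finite product of powers whose
  exponents are counts of bounded Borel sets; the general case is a pointwise limit.\<close>

lemma measurable_config_prod:
  fixes f :: "'a::euclidean_space \<Rightarrow> real"
  assumes f: "f \<in> borel_measurable borel" and A: "A \<in> sets borel" "bounded A"
  shows "(\<lambda>\<xi>. prod f (\<xi> \<inter> A)) \<in> borel_measurable config_space"
proof -
  obtain F where F: "\<And>i. simple_function borel (F i)" "\<And>x. (\<lambda>i. F i x) \<longlonglongrightarrow> f x"
    using borel_measurable_implies_sequence_metric[OF f, of 0] by auto
  have "(\<lambda>\<xi>. prod (F i) (\<xi> \<inter> A)) \<in> borel_measurable config_space" for i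
  proof -
    have fin: "finite (range (F i))" and sets: "F i -` {v} \<in> sets borel" for v
      using F(1)[of i] simple_functionD[OF F(1)[of i]] by auto
    have "(\<lambda>\<xi>. \<Prod>v\<in>range (F i). v ^ card (\<xi> \<inter> (A \<inter> F i -` {v}))) \<in> borel_measurable config_space"
    proof (intro borel_measurable_prod measurable_compose[OF measurable_config_count])
      fix v show "A \<inter> F i -` {v} \<in> sets borel" using sets A by auto
      show "bounded (A \<inter> F i -` {v})" using A by (auto intro: bounded_subset)
    qed simp
    moreover have "(\<Prod>v\<in>range (F i). v ^ card (\<xi> \<inter> (A \<inter> F i -` {v}))) = prod (F i) (\<xi> \<inter> A)"
      if "\<xi> \<in> configs" for \<xi>
    proof -
      have "(\<Prod>v\<in>range (F i). v ^ card (\<xi> \<inter> (A \<inter> F i -` {v})))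
          = (\<Prod>v\<in>range (F i). prod (F i) {x \<in> \<xi> \<inter> A. F i x = v})"
      proof (intro prod.cong refl)
        fix v
        have "{x \<in> \<xi> \<inter> A. F i x = v} = \<xi> \<inter> (A \<inter> F i -` {v})" by auto
        then show "v ^ card (\<xi> \<inter> (A \<inter> F i -` {v})) = prod (F i) {x \<in> \<xi> \<inter> A. F i x = v}"
          by simp
      qed
      also have "\<dots> = prod (F i) (\<xi> \<inter> A)"
        using that A fin by (intro prod.group) (auto simp: finite_config_Int)
      finally show ?thesis .
    qed
    ultimately show ?thesis
      by (subst (asm) measurable_cong) auto
  qed
  moreover have "(\<lambda>i. prod (F i) (\<xi> \<inter> A)) \<longlonglongrightarrow> prod f (\<xi> \<inter> A)" for \<xi>
    by (intro tendsto_prod F(2))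
  ultimately show ?thesis
    by (rule borel_measurable_LIMSEQ_real[rotated])
qed

lemma measurable_config_translate:
  "(\<lambda>\<xi>. (\<lambda>x. a + x) ` \<xi>) \<in> measurable config_space (config_space :: 'a::euclidean_space set measure)"
proof -
  have img: "(\<lambda>x. a + x) ` \<xi> \<inter> A = (\<lambda>x. a + x) ` (\<xi> \<inter> (\<lambda>x. a + x) -` A)" for \<xi> A
    by auto
  have vim: "(\<lambda>x. a + x) -` A = (\<lambda>x. - a + x) ` A" for A
    by (force simp: image_iff)
  have bnd: "bounded ((\<lambda>x. a + x) -` A)" if "bounded A" for A
    unfolding vim using that by (rule bounded_translation)
  have conf: "(\<lambda>x. a + x) ` \<xi> \<in> configs" if "\<xi> \<in> configs" for \<xi>
    unfolding configs_def mem_Collect_eq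
    by (auto simp: img intro!: finite_imageI finite_config_Int that bnd)
  show ?thesis
    unfolding config_space_def
  proof (rule measurable_measure_of)
    fix y :: "'a set set"
    assume "y \<in> {{\<xi> \<in> configs. card (\<xi> \<inter> A) = n} | A n. A \<in> sets borel \<and> bounded A}"
    then obtain A n where y: "y = {\<xi> \<in> configs. card (\<xi> \<inter> A) = n}" "A \<in> sets borel" "bounded A"
      by auto
    have "(\<lambda>\<xi>. (\<lambda>x. a + x) ` \<xi>) -` y \<inter> configs = {\<xi> \<in> configs. card (\<xi> \<inter> (\<lambda>x. a + x) -` A) = n}"
      unfolding y by (auto simp: img card_image conf)
    moreover have "(\<lambda>x. a + x) -` A \<in> sets borel"
      using measurable_sets[of "\<lambda>x. a + x" borel borel A] y by simp
    ultimately show "(\<lambda>\<xi>. (\<lambda>x. a + x) ` \<xi>) -` y \<inter> space (sigma configs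
      {{\<xi> \<in> configs. card (\<xi> \<inter> A) = n} |A n. A \<in> sets borel \<and> bounded A})
      \<in> sets (sigma configs
      {{\<xi> \<in> configs. card (\<xi> \<inter> A) = n} |A n. A \<in> sets borel \<and> bounded A})"
      using sets_config_count[of "(\<lambda>x. a + x) -` A" n] bnd y space_config_space[where 'a='a]
      by (simp add: config_space_def)
  qed (use conf space_config_space[where 'a='a] in \<open>auto simp: config_space_def\<close>)
qed

text \<open>Only finitely many points lie near \<open>x\<close>, so a closed ball without points can be enlarged
  slightly and stay free of points.\<close>

lemma config_gap:
  fixes x :: "'a::euclidean_space"
  assumes "\<xi> \<in> configs" "\<xi> \<inter> cball x t = {}"
  obtains n :: nat where "\<xi> \<inter> cball x (t + 2 / (real n + 1)) = {}"
proof -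
  let ?S = "\<xi> \<inter> cball x (t + 2)"
  have lim: "(\<lambda>n. t + 2 / (real n + 1)) \<longlonglongrightarrow> t"
    using tendsto_add[OF tendsto_const[of t] tendsto_mult[OF tendsto_const[of 2] LIMSEQ_inverse_real_of_nat]]
    by (simp add: divide_inverse add.commute)
  have "\<forall>\<^sub>F n in sequentially. \<forall>y\<in>?S. t + 2 / (real n + 1) < dist x y"
  proof (rule eventually_ball_finite)
    show "finite ?S" using assms by (simp add: finite_config_Int)
    show "\<forall>y\<in>?S. \<forall>\<^sub>F n in sequentially. t + 2 / (real n + 1) < dist x y"
      using assms(2) by (intro ballI order_tendstoD(2)[OF lim]) auto
  qed
  then obtain n where n: "\<forall>y\<in>?S. t + 2 / (real n + 1) < dist x y"
    using eventually_happens' sequentially_bot by blast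
  have "t + 2 / (real n + 1) \<le> t + 2" using frac_le[of 2 2 1 "real n + 1"] by simp
  with n have "\<xi> \<inter> cball x (t + 2 / (real n + 1)) = {}"
    by (force simp: not_le)
  then show thesis by (rule that)
qed

text \<open>Joint measurability in centre and configuration: by the gap around an empty ball, a ball
  is empty iff it lies in an empty ball from a countable family, with centre in a dense set and
  radius \<open>t + 1 / (n + 1)\<close>.\<close>

lemma measurable_empty_ball:
  "Measurable.pred (borel \<Otimes>\<^sub>M config_space)
     (\<lambda>(x, \<xi>). \<xi> \<inter> cball x t = ({} :: 'a::euclidean_space set))"
proof -
  obtain D :: "'a set" where D: "countable D" "\<And>X. open X \<Longrightarrow> X \<noteq> {} \<Longrightarrow> \<exists>d\<in>D. d \<in> X"
    using countable_dense_exists by blast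
  let ?e = "\<lambda>n. 1 / (real n + 1)"
  let ?E = "\<lambda>n q. {\<xi> \<in> configs. card (\<xi> \<inter> cball q (t + ?e n)) = 0}"
  have "{(x, \<xi>) \<in> space (borel \<Otimes>\<^sub>M config_space). \<xi> \<inter> cball x t = {}}
      = (\<Union>n. \<Union>q\<in>D. cball q (?e n) \<times> ?E n q)" (is "?L = ?R")
  proof (intro equalityI subsetI)
    fix p assume "p \<in> ?L"
    then obtain x \<xi> where p: "p = (x, \<xi>)" "\<xi> \<in> configs" "\<xi> \<inter> cball x t = {}"
      by (auto simp: space_pair_measure)
    obtain n where n: "\<xi> \<inter> cball x (t + 2 / (real n + 1)) = {}"
      using config_gap p(2,3) .
    obtain q where q: "q \<in> D" "dist x q < ?e n"
      using D(2)[of "ball x (?e n)"] by auto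
    have "cball q (t + ?e n) \<subseteq> cball x (t + 2 / (real n + 1))"
    proof
      fix y assume "y \<in> cball q (t + ?e n)"
      then have "dist x y \<le> ?e n + (t + ?e n)"
        using dist_triangle[of x y q] q by auto
      then show "y \<in> cball x (t + 2 / (real n + 1))"
        by (simp add: field_simps)
    qed
    with n have "\<xi> \<inter> cball q (t + ?e n) = {}" by blast
    then show "p \<in> ?R"
      using p q by (auto simp: dist_commute intro!: exI[of _ n] bexI[of _ q])
  next
    fix p assume "p \<in> ?R"
    then obtain n q x \<xi> where p: "p = (x, \<xi>)" "\<xi> \<in> configs" "dist q x \<le> ?e n"
      "card (\<xi> \<inter> cball q (t + ?e n)) = 0" by auto
    have "\<xi> \<inter> cball q (t + ?e n) = {}"
      using p(4) finite_config_Int[OF p(2) bounded_cball] by simp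
    moreover have "cball x t \<subseteq> cball q (t + ?e n)"
    proof
      fix y assume "y \<in> cball x t"
      then show "y \<in> cball q (t + ?e n)"
        using dist_triangle[of q y x] p(3) by auto
    qed
    ultimately show "p \<in> ?L" using p by (auto simp: space_pair_measure)
  qed
  moreover have "?R \<in> sets (borel \<Otimes>\<^sub>M config_space)"
    using D(1) by (intro sets.countable_UN' sets.countable_UN image_subsetI countableI_type
        pair_measureI sets_config_count) auto
  ultimately show ?thesis
    by (simp add: pred_def case_prod_unfold)
qed


section \<open>The generating functional of a repulsive Gibbs process\<close>

text \<open>In the application \<open>r \<omega>\<close> is a sum over the points of \<open>\<Xi> \<omega>\<close>. Allowing an arbitrary
  \<open>r\<close> in this lemma and the next saves a proof that such sums are measurable; its integral is
  compared with that of the measurable function \<open>f - g\<close>.\<close>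

lemma nn_integral_le_add_nonmeasurable:
  fixes f g r :: "'w \<Rightarrow> ennreal"
  assumes [measurable]: "f \<in> borel_measurable M" "g \<in> borel_measurable M"
    and le: "\<And>\<omega>. \<omega> \<in> space M \<Longrightarrow> f \<omega> \<le> g \<omega> + r \<omega>" and fin: "\<And>\<omega>. g \<omega> < top"
  shows "(\<integral>\<^sup>+\<omega>. f \<omega> \<partial>M) \<le> (\<integral>\<^sup>+\<omega>. g \<omega> \<partial>M) + (\<integral>\<^sup>+\<omega>. r \<omega> \<partial>M)"
proof -
  have "(\<integral>\<^sup>+\<omega>. f \<omega> \<partial>M) \<le> (\<integral>\<^sup>+\<omega>. g \<omega> + (f \<omega> - g \<omega>) \<partial>M)"
  proof (intro nn_integral_mono)
    fix \<omega> show "f \<omega> \<le> g \<omega> + (f \<omega> - g \<omega>)"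
      by (cases "g \<omega> \<le> f \<omega>") (auto simp: add_diff_inverse_ennreal not_le intro: add_increasing2 less_imp_le)
  qed
  also have "\<dots> = (\<integral>\<^sup>+\<omega>. g \<omega> \<partial>M) + (\<integral>\<^sup>+\<omega>. f \<omega> - g \<omega> \<partial>M)"
    by (rule nn_integral_add) auto
  also have "(\<integral>\<^sup>+\<omega>. f \<omega> - g \<omega> \<partial>M) \<le> (\<integral>\<^sup>+\<omega>. r \<omega> \<partial>M)"
    using le fin by (intro nn_integral_mono) (metis ennreal_minus_le_iff less_irrefl)
  finally show ?thesis by (simp add: add_left_mono)
qed

lemma nn_integral_add_le_nonmeasurable:
  fixes f g r :: "'w \<Rightarrow> ennreal"
  assumes [measurable]: "f \<in> borel_measurable M" "g \<in> borel_measurable M"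
    and le: "\<And>\<omega>. \<omega> \<in> space M \<Longrightarrow> g \<omega> + r \<omega> \<le> f \<omega>" and fin: "\<And>\<omega>. g \<omega> < top"
  shows "(\<integral>\<^sup>+\<omega>. g \<omega> \<partial>M) + (\<integral>\<^sup>+\<omega>. r \<omega> \<partial>M) \<le> (\<integral>\<^sup>+\<omega>. f \<omega> \<partial>M)"
proof -
  have "(\<integral>\<^sup>+\<omega>. r \<omega> \<partial>M) \<le> (\<integral>\<^sup>+\<omega>. f \<omega> - g \<omega> \<partial>M)"
    using le fin by (intro nn_integral_mono) (simp add: ennreal_le_minus_iff add.commute)
  then have "(\<integral>\<^sup>+\<omega>. g \<omega> \<partial>M) + (\<integral>\<^sup>+\<omega>. r \<omega> \<partial>M) \<le> (\<integral>\<^sup>+\<omega>. g \<omega> \<partial>M) + (\<integral>\<^sup>+\<omega>. f \<omega> - g \<omega> \<partial>M)"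
    by (rule add_left_mono)
  also have "\<dots> = (\<integral>\<^sup>+\<omega>. g \<omega> + (f \<omega> - g \<omega>) \<partial>M)"
    by (rule nn_integral_add[symmetric]) auto
  also have "\<dots> = (\<integral>\<^sup>+\<omega>. f \<omega> \<partial>M)"
  proof (intro nn_integral_cong add_diff_inverse_ennreal)
    fix \<omega> assume "\<omega> \<in> space M"
    from le[OF this] show "g \<omega> \<le> f \<omega>"
      by (metis add.right_neutral add_left_mono order_trans zero_le)
  qed
  finally show ?thesis .
qed

locale repulsive_gibbs =
  fixes M :: "'w measure" and \<Xi> :: "'w \<Rightarrow> 'a::euclidean_space set"
    and ci :: "'a \<Rightarrow> 'a set \<Rightarrow> real" and \<beta> l :: real
  assumes gibbs: "gibbs_process M \<Xi> ci"
    and beta_pos: "0 < \<beta>"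
    and ci_le: "\<xi> \<in> configs \<Longrightarrow> ci x \<xi> \<le> \<beta>"
    and ci_antimono: "\<xi> \<in> configs \<Longrightarrow> ci x \<xi> \<le> ci x (\<xi> - {z})"
    and mean_ci: "(\<integral>\<omega>. ci x (\<Xi> \<omega>) \<partial>M) = l"
begin

sublocale prob_space M
  using gibbs by (simp add: gibbs_process_def point_process_def)

lemma Xi_measurable [measurable]: "\<Xi> \<in> measurable M config_space"
  using gibbs by (simp add: gibbs_process_def point_process_def)

lemma Xi_config: "\<omega> \<in> space M \<Longrightarrow> \<Xi> \<omega> \<in> configs"
  using measurable_space[OF Xi_measurable] by simp

lemma ci_measurable2 [measurable]: "(\<lambda>(x, \<xi>). ci x \<xi>) \<in> borel_measurable (borel \<Otimes>\<^sub>M config_space)"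
  using gibbs by (simp add: gibbs_process_def)

lemma ci_measurable [measurable]: "ci x \<in> borel_measurable config_space"
  using measurable_compose[OF measurable_Pair1'[of x borel config_space] ci_measurable2] by simp

lemma ci_nonneg: "\<xi> \<in> configs \<Longrightarrow> 0 \<le> ci x \<xi>"
  using gibbs by (auto simp: gibbs_process_def)

lemma gnz:
  fixes h :: "'a \<times> 'a set \<Rightarrow> real"
  assumes "h \<in> borel_measurable (borel \<Otimes>\<^sub>M config_space)" "\<And>x \<xi>. \<xi> \<in> configs \<Longrightarrow> 0 \<le> h (x, \<xi>)"
  shows "(\<integral>\<^sup>+ \<omega>. (\<integral>\<^sup>+ x. ennreal (h (x, \<Xi> \<omega> - {x})) \<partial>count_space (\<Xi> \<omega>)) \<partial>M) =
        (\<integral>\<^sup>+ x. (\<integral>\<^sup>+ \<omega>. ennreal (h (x, \<Xi> \<omega>) * ci x (\<Xi> \<omega>)) \<partial>M) \<partial>lborel)"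
  using gibbs assms unfolding gibbs_process_def by blast

lemma integrable_Xi:
  assumes [measurable]: "f \<in> borel_measurable config_space"
    and "\<And>\<xi>. \<xi> \<in> configs \<Longrightarrow> 0 \<le> f \<xi>" "\<And>\<xi>. \<xi> \<in> configs \<Longrightarrow> f \<xi> \<le> (b::real)"
  shows "integrable M (\<lambda>\<omega>. f (\<Xi> \<omega>))"
  using assms(2,3) Xi_config by (intro integrable_const_bound[of _ b]) auto

lemma nn_integral_Xi:
  assumes "f \<in> borel_measurable config_space"
    and "\<And>\<xi>. \<xi> \<in> configs \<Longrightarrow> 0 \<le> f \<xi>" "\<And>\<xi>. \<xi> \<in> configs \<Longrightarrow> f \<xi> \<le> (b::real)"
  shows "(\<integral>\<^sup>+\<omega>. ennreal (f (\<Xi> \<omega>)) \<partial>M) = ennreal (\<integral>\<omega>. f (\<Xi> \<omega>) \<partial>M)"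
  using integrable_Xi[OF assms] assms(2) Xi_config by (intro nn_integral_eq_integral) auto

end

text \<open>Only points in \<open>W\<close> contribute to the generating functional \<open>E[\<Prod>y\<in>\<Xi>. 1 - s u y]\<close>, so its
  products have finitely many factors.\<close>

locale repulsive_gibbs_window = repulsive_gibbs M \<Xi> ci \<beta> l
  for M :: "'w measure" and \<Xi> :: "'w \<Rightarrow> 'a::euclidean_space set"
    and ci :: "'a \<Rightarrow> 'a set \<Rightarrow> real" and \<beta> l :: real +
  fixes u :: "'a \<Rightarrow> real" and W :: "'a set"
  assumes u_measurable [measurable]: "u \<in> borel_measurable borel"
    and u_nonneg: "\<And>x. 0 \<le> u x" and u_le: "\<And>x. u x \<le> 1"
    and u_supp: "\<And>x. x \<notin> W \<Longrightarrow> u x = 0"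
    and W_sets [measurable]: "W \<in> sets borel" and W_bounded: "bounded W"
begin

definition thin :: "real \<Rightarrow> 'a set \<Rightarrow> real" where
  "thin s \<xi> = (\<Prod>y\<in>\<xi> \<inter> W. 1 - s * u y)"

lemma thin_measurable [measurable]: "thin s \<in> borel_measurable config_space"
  unfolding thin_def by (intro measurable_config_prod W_bounded) measurable

lemma su_bounds: "0 \<le> s \<Longrightarrow> s \<le> 1 \<Longrightarrow> 0 \<le> s * u x \<and> s * u x \<le> 1"
  using u_nonneg u_le by (auto intro: mult_le_one)

lemma thin_nonneg: "0 \<le> s \<Longrightarrow> s \<le> 1 \<Longrightarrow> 0 \<le> thin s \<xi>"
  unfolding thin_def using su_bounds by (intro prod_nonneg) auto

lemma thin_le_1: "0 \<le> s \<Longrightarrow> s \<le> 1 \<Longrightarrow> thin s \<xi> \<le> 1"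
  unfolding thin_def using su_bounds by (intro prod_le_1) auto

lemma thin_0 [simp]: "thin 0 \<xi> = 1"
  by (simp add: thin_def)

lemma integrable_u: "integrable lborel u"
proof (rule Bochner_Integration.integrable_bound)
  have "emeasure lborel W < \<infinity>" using W_bounded by (rule emeasure_bounded_finite)
  then show "integrable lborel (indicator W :: 'a \<Rightarrow> real)" by simp
  show "AE x in lborel. norm (u x) \<le> norm (indicator W x :: real)"
    using u_nonneg u_le u_supp by (auto simp: indicator_def)
qed simp

lemma nn_integral_u: "(\<integral>\<^sup>+x. ennreal (u x) \<partial>lborel) = ennreal (\<integral>x. u x \<partial>lborel)"
  using integrable_u u_nonneg by (intro nn_integral_eq_integral) auto

lemma nn_integral_u_mult:
  "(\<integral>\<^sup>+x. ennreal (u x) * ennreal r \<partial>lborel) = ennreal ((\<integral>x. u x \<partial>lborel) * r)"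
  using u_nonneg by (subst nn_integral_multc) (auto simp: nn_integral_u ennreal_mult' integral_nonneg_AE)

lemma count_space_sum:
  assumes "\<xi> \<in> configs" "\<And>\<eta>. \<eta> \<in> configs \<Longrightarrow> 0 \<le> f \<eta>"
  shows "(\<integral>\<^sup>+x. ennreal (u x * f (\<xi> - {x})) \<partial>count_space \<xi>)
    = ennreal (\<Sum>x\<in>\<xi> \<inter> W. u x * f (\<xi> - {x}))"
proof -
  have "(\<integral>\<^sup>+x. ennreal (u x * f (\<xi> - {x})) \<partial>count_space \<xi>)
      = (\<Sum>x\<in>\<xi> \<inter> W. ennreal (u x * f (\<xi> - {x})))"
    using assms(1) u_supp W_bounded
    by (intro nn_integral_count_space') (auto simp: finite_config_Int)
  also have "\<dots> = ennreal (\<Sum>x\<in>\<xi> \<inter> W. u x * f (\<xi> - {x}))"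
    using assms u_nonneg by (intro sum_ennreal) (auto intro!: mult_nonneg_nonneg config_Diff)
  finally show ?thesis .
qed

lemma gnz_u:
  assumes f [measurable]: "f \<in> borel_measurable config_space"
    and f_nonneg: "\<And>\<xi>. \<xi> \<in> configs \<Longrightarrow> 0 \<le> f \<xi>"
  shows "(\<integral>\<^sup>+\<omega>. (\<integral>\<^sup>+x. ennreal (u x * f (\<Xi> \<omega> - {x})) \<partial>count_space (\<Xi> \<omega>)) \<partial>M)
    = (\<integral>\<^sup>+x. ennreal (u x) * (\<integral>\<^sup>+\<omega>. ennreal (ci x (\<Xi> \<omega>) * f (\<Xi> \<omega>)) \<partial>M) \<partial>lborel)"
proof -
  have "(\<integral>\<^sup>+\<omega>. ennreal (u x * f (\<Xi> \<omega>) * ci x (\<Xi> \<omega>)) \<partial>M)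
      = ennreal (u x) * (\<integral>\<^sup>+\<omega>. ennreal (ci x (\<Xi> \<omega>) * f (\<Xi> \<omega>)) \<partial>M)" for x
    using u_nonneg by (subst nn_integral_cmult[symmetric])
      (measurable, simp add: ac_simps flip: ennreal_mult')
  then show ?thesis
    using gnz[of "\<lambda>(x, \<xi>). u x * f \<xi>"] f_nonneg u_nonneg by simp
qed

lemma thin_upper:
  assumes "\<xi> \<in> configs" "0 \<le> s" "s \<le> s'" "s' \<le> 1"
  shows "thin s \<xi> \<le> thin s' \<xi> + (\<Sum>x\<in>\<xi> \<inter> W. u x * ((s' - s) * thin s (\<xi> - {x})))"
proof -
  have "thin s (\<xi> - {x}) = (\<Prod>y\<in>\<xi> \<inter> W - {x}. 1 - s * u y)" for x
    unfolding thin_def by (intro prod.cong) auto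
  moreover have "finite (\<xi> \<inter> W)" using assms W_bounded by (simp add: finite_config_Int)
  ultimately show ?thesis
    using prod_telescope_upper[of "\<xi> \<inter> W" "\<lambda>y. 1 - s' * u y" "\<lambda>y. 1 - s * u y"]
      su_bounds[of s'] assms u_nonneg
    by (simp add: thin_def mult_right_mono algebra_simps)
qed

lemma thin_lower:
  assumes "\<xi> \<in> configs" "0 \<le> s" "s \<le> s'" "s' \<le> 1"
  shows "thin s' \<xi> + (\<Sum>x\<in>\<xi> \<inter> W. u x * ((s' - s) * thin s' (\<xi> - {x}))) \<le> thin s \<xi>"
proof -
  have "thin s' (\<xi> - {x}) = (\<Prod>y\<in>\<xi> \<inter> W - {x}. 1 - s' * u y)" for x
    unfolding thin_def by (intro prod.cong) auto
  moreover have "finite (\<xi> \<inter> W)" using assms W_bounded by (simp add: finite_config_Int)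
  ultimately show ?thesis
    using prod_telescope_lower[of "\<xi> \<inter> W" "\<lambda>y. 1 - s' * u y" "\<lambda>y. 1 - s * u y"]
      su_bounds[of s'] assms u_nonneg
    by (simp add: thin_def mult_right_mono algebra_simps)
qed

definition \<Psi> :: "real \<Rightarrow> real" where
  "\<Psi> s = (\<integral>\<omega>. thin s (\<Xi> \<omega>) \<partial>M)"

text \<open>By the Gibbs equation, \<open>ci x \<Xi> / l\<close> is a density of the reduced Palm distribution at \<open>x\<close>
  with respect to the law of \<open>\<Xi>\<close>; so \<open>palm x s / l\<close> is the generating functional of that
  distribution.\<close>

definition palm :: "'a \<Rightarrow> real \<Rightarrow> real" where
  "palm x s = (\<integral>\<omega>. ci x (\<Xi> \<omega>) * thin s (\<Xi> \<omega>) \<partial>M)"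

abbreviation mass :: real where
  "mass \<equiv> (\<integral>x. u x \<partial>lborel)"

lemma mass_nonneg: "0 \<le> mass"
  using u_nonneg by (simp add: integral_nonneg_AE)

lemma nn_Psi: "0 \<le> s \<Longrightarrow> s \<le> 1 \<Longrightarrow> (\<integral>\<^sup>+\<omega>. ennreal (thin s (\<Xi> \<omega>)) \<partial>M) = ennreal (\<Psi> s)"
  unfolding \<Psi>_def by (intro nn_integral_Xi[where b = 1]) (auto simp: thin_nonneg thin_le_1)

lemma ci_thin_bounds:
  assumes "\<xi> \<in> configs" "0 \<le> s" "s \<le> 1"
  shows "0 \<le> ci x \<xi> * thin s \<xi>" "ci x \<xi> * thin s \<xi> \<le> \<beta>"
proof -
  show "0 \<le> ci x \<xi> * thin s \<xi>" using assms ci_nonneg thin_nonneg by simp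
  have "ci x \<xi> * thin s \<xi> \<le> \<beta> * 1"
    using assms ci_le ci_nonneg thin_nonneg thin_le_1 beta_pos by (intro mult_mono) auto
  then show "ci x \<xi> * thin s \<xi> \<le> \<beta>" by simp
qed

lemma nn_palm: "0 \<le> s \<Longrightarrow> s \<le> 1 \<Longrightarrow>
    (\<integral>\<^sup>+\<omega>. ennreal (ci x (\<Xi> \<omega>) * thin s (\<Xi> \<omega>)) \<partial>M) = ennreal (palm x s)"
  unfolding palm_def by (intro nn_integral_Xi[where b = \<beta>]) (auto simp: ci_thin_bounds)

lemma Psi_nonneg: "0 \<le> s \<Longrightarrow> s \<le> 1 \<Longrightarrow> 0 \<le> \<Psi> s"
  unfolding \<Psi>_def by (simp add: thin_nonneg)

lemma palm_nonneg: "0 \<le> s \<Longrightarrow> s \<le> 1 \<Longrightarrow> 0 \<le> palm x s"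
  unfolding palm_def by (intro integral_nonneg_AE AE_I2 ci_thin_bounds Xi_config)

lemma Psi_0: "\<Psi> 0 = 1"
  by (simp add: \<Psi>_def prob_space)

lemma palm_0: "palm x 0 = l"
  by (simp add: palm_def mean_ci)

lemma l_nonneg: "0 \<le> l"
  using palm_nonneg[of 0] palm_0 by simp

text \<open>Weierstrass' inequality \<open>1 \<le> \<Prod>(1 - u y) + \<Sum>u y\<close>, whose sum has expectation \<open>l * mass\<close> by
  the Gibbs equation.\<close>

lemma Psi_ge: "1 - l * mass \<le> \<Psi> 1"
proof -
  have "(\<integral>\<^sup>+\<omega>. ennreal (thin 0 (\<Xi> \<omega>)) \<partial>M) \<le> (\<integral>\<^sup>+\<omega>. ennreal (thin 1 (\<Xi> \<omega>)) \<partial>M)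
      + (\<integral>\<^sup>+\<omega>. (\<integral>\<^sup>+x. ennreal (u x * thin 0 (\<Xi> \<omega> - {x})) \<partial>count_space (\<Xi> \<omega>)) \<partial>M)"
  proof (intro nn_integral_le_add_nonmeasurable)
    fix \<omega> assume "\<omega> \<in> space M"
    note c = Xi_config[OF this]
    have "ennreal (thin 0 (\<Xi> \<omega>))
        \<le> ennreal (thin 1 (\<Xi> \<omega>) + (\<Sum>x\<in>\<Xi> \<omega> \<inter> W. u x * thin 0 (\<Xi> \<omega> - {x})))"
      using thin_upper[OF c, of 0 1] by (intro ennreal_leI) simp
    also have "\<dots> = ennreal (thin 1 (\<Xi> \<omega>))
        + ennreal (\<Sum>x\<in>\<Xi> \<omega> \<inter> W. u x * thin 0 (\<Xi> \<omega> - {x}))"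
      using u_nonneg thin_nonneg by (intro ennreal_plus) (auto intro!: sum_nonneg)
    finally show "ennreal (thin 0 (\<Xi> \<omega>)) \<le> ennreal (thin 1 (\<Xi> \<omega>))
        + (\<integral>\<^sup>+x. ennreal (u x * thin 0 (\<Xi> \<omega> - {x})) \<partial>count_space (\<Xi> \<omega>))"
      using count_space_sum[OF c, of "thin 0"] by simp
  qed auto
  also have "(\<integral>\<^sup>+\<omega>. (\<integral>\<^sup>+x. ennreal (u x * thin 0 (\<Xi> \<omega> - {x})) \<partial>count_space (\<Xi> \<omega>)) \<partial>M)
      = (\<integral>\<^sup>+x. ennreal (u x) * (\<integral>\<^sup>+\<omega>. ennreal (ci x (\<Xi> \<omega>) * thin 0 (\<Xi> \<omega>)) \<partial>M) \<partial>lborel)"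
    by (rule gnz_u) (auto simp del: thin_0 simp: thin_nonneg)
  also have "\<dots> = (\<integral>\<^sup>+x. ennreal (u x) * ennreal l \<partial>lborel)"
    by (subst nn_palm) (auto simp: palm_0)
  also have "\<dots> = ennreal (mass * l)"
    using l_nonneg mass_nonneg by (simp only: nn_integral_u_mult)
  finally have "ennreal (\<Psi> 0) \<le> ennreal (\<Psi> 1) + ennreal (mass * l)"
    by (simp only: nn_Psi order.refl zero_le_one)
  also have "\<dots> = ennreal (\<Psi> 1 + mass * l)"
    using Psi_nonneg l_nonneg mass_nonneg by (intro ennreal_plus[symmetric]) auto
  finally show ?thesis
    using Psi_nonneg[of 1] l_nonneg mass_nonneg
    by (subst (asm) ennreal_le_iff) (auto simp: Psi_0 mult.commute)
qed

text \<open>The discrete form of \<open>(palm x)' \<ge> - \<beta> mass palm x\<close>. Passing from \<open>s\<close> to \<open>s'\<close> costs a sum over the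
  points \<open>z\<close> of \<open>\<Xi>\<close>; there \<open>ci x \<Xi> \<le> ci x (\<Xi> - {z})\<close> brings every summand into the form
  required by the Gibbs equation, whose factor \<open>ci z \<Xi>\<close> is at most \<open>\<beta>\<close>.\<close>

lemma palm_step:
  assumes "0 \<le> s" "s \<le> s'" "s' \<le> 1"
  shows "(1 - (s' - s) * (\<beta> * mass)) * palm x s \<le> palm x s'"
proof -
  define f where "f = (\<lambda>\<xi>. (s' - s) * (ci x \<xi> * thin s \<xi>))"
  have f [measurable]: "f \<in> borel_measurable config_space" unfolding f_def by measurable
  have f_nonneg: "0 \<le> f \<xi>" if "\<xi> \<in> configs" for \<xi>
    unfolding f_def using assms that by (intro mult_nonneg_nonneg ci_thin_bounds) auto
  have "(\<integral>\<^sup>+\<omega>. ennreal (ci x (\<Xi> \<omega>) * thin s (\<Xi> \<omega>)) \<partial>M)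
      \<le> (\<integral>\<^sup>+\<omega>. ennreal (ci x (\<Xi> \<omega>) * thin s' (\<Xi> \<omega>)) \<partial>M)
      + (\<integral>\<^sup>+\<omega>. (\<integral>\<^sup>+z. ennreal (u z * f (\<Xi> \<omega> - {z})) \<partial>count_space (\<Xi> \<omega>)) \<partial>M)"
  proof (intro nn_integral_le_add_nonmeasurable)
    fix \<omega> assume "\<omega> \<in> space M"
    note c = Xi_config[OF this]
    have "ci x (\<Xi> \<omega>) * thin s (\<Xi> \<omega>) \<le> ci x (\<Xi> \<omega>) * (thin s' (\<Xi> \<omega>)
        + (\<Sum>z\<in>\<Xi> \<omega> \<inter> W. u z * ((s' - s) * thin s (\<Xi> \<omega> - {z}))))"
      using c assms by (intro mult_left_mono thin_upper ci_nonneg)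
    also have "\<dots> \<le> ci x (\<Xi> \<omega>) * thin s' (\<Xi> \<omega>) + (\<Sum>z\<in>\<Xi> \<omega> \<inter> W. u z * f (\<Xi> \<omega> - {z}))"
      unfolding distrib_left sum_distrib_left
    proof (intro add_left_mono sum_mono)
      fix z
      have "ci x (\<Xi> \<omega>) * (u z * ((s' - s) * thin s (\<Xi> \<omega> - {z})))
          \<le> ci x (\<Xi> \<omega> - {z}) * (u z * ((s' - s) * thin s (\<Xi> \<omega> - {z})))"
        using c assms u_nonneg thin_nonneg by (intro mult_right_mono ci_antimono) auto
      then show "ci x (\<Xi> \<omega>) * (u z * ((s' - s) * thin s (\<Xi> \<omega> - {z})))
          \<le> u z * f (\<Xi> \<omega> - {z})"
        by (simp add: f_def ac_simps)
    qed
    finally have "ennreal (ci x (\<Xi> \<omega>) * thin s (\<Xi> \<omega>)) \<le> ennreal (ci x (\<Xi> \<omega>) * thin s' (\<Xi> \<omega>)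
        + (\<Sum>z\<in>\<Xi> \<omega> \<inter> W. u z * f (\<Xi> \<omega> - {z})))"
      by (rule ennreal_leI)
    also have "\<dots> = ennreal (ci x (\<Xi> \<omega>) * thin s' (\<Xi> \<omega>))
        + ennreal (\<Sum>z\<in>\<Xi> \<omega> \<inter> W. u z * f (\<Xi> \<omega> - {z}))"
      using u_nonneg assms c
      by (intro ennreal_plus sum_nonneg mult_nonneg_nonneg f_nonneg config_Diff ci_nonneg thin_nonneg)
        auto
    finally show "ennreal (ci x (\<Xi> \<omega>) * thin s (\<Xi> \<omega>)) \<le> ennreal (ci x (\<Xi> \<omega>) * thin s' (\<Xi> \<omega>))
        + (\<integral>\<^sup>+z. ennreal (u z * f (\<Xi> \<omega> - {z})) \<partial>count_space (\<Xi> \<omega>))"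
      using count_space_sum[OF c, of f] f_nonneg by presburger
  qed auto
  also have "(\<integral>\<^sup>+\<omega>. (\<integral>\<^sup>+z. ennreal (u z * f (\<Xi> \<omega> - {z})) \<partial>count_space (\<Xi> \<omega>)) \<partial>M)
      = (\<integral>\<^sup>+z. ennreal (u z) * (\<integral>\<^sup>+\<omega>. ennreal (ci z (\<Xi> \<omega>) * f (\<Xi> \<omega>)) \<partial>M) \<partial>lborel)"
    by (intro gnz_u f_nonneg f)
  also have "\<dots> \<le> (\<integral>\<^sup>+z. ennreal (u z) * ennreal (\<beta> * (s' - s) * palm x s) \<partial>lborel)"
  proof (intro nn_integral_mono mult_left_mono)
    fix z
    have "(\<integral>\<^sup>+\<omega>. ennreal (ci z (\<Xi> \<omega>) * f (\<Xi> \<omega>)) \<partial>M)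
        \<le> (\<integral>\<^sup>+\<omega>. ennreal (\<beta> * (s' - s)) * ennreal (ci x (\<Xi> \<omega>) * thin s (\<Xi> \<omega>)) \<partial>M)"
    proof (intro nn_integral_mono)
      fix \<omega> assume "\<omega> \<in> space M"
      note c = Xi_config[OF this]
      have "ci z (\<Xi> \<omega>) * f (\<Xi> \<omega>) \<le> \<beta> * f (\<Xi> \<omega>)"
        using c by (intro mult_right_mono ci_le f_nonneg)
      then show "ennreal (ci z (\<Xi> \<omega>) * f (\<Xi> \<omega>))
          \<le> ennreal (\<beta> * (s' - s)) * ennreal (ci x (\<Xi> \<omega>) * thin s (\<Xi> \<omega>))"
        using beta_pos assms by (simp add: f_def ennreal_leI mult.assoc flip: ennreal_mult')
    qed
    also have "\<dots> = ennreal (\<beta> * (s' - s) * palm x s)"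
      using assms beta_pos by (subst nn_integral_cmult) (simp_all add: nn_palm ennreal_mult')
    finally show "(\<integral>\<^sup>+\<omega>. ennreal (ci z (\<Xi> \<omega>) * f (\<Xi> \<omega>)) \<partial>M)
        \<le> ennreal (\<beta> * (s' - s) * palm x s)" .
  qed auto
  also have "\<dots> = ennreal (mass * (\<beta> * (s' - s) * palm x s))"
    by (simp only: nn_integral_u_mult)
  finally have "ennreal (palm x s) \<le> ennreal (palm x s') + ennreal (mass * (\<beta> * (s' - s) * palm x s))"
    using assms by (simp add: nn_palm add_left_mono)
  also have "\<dots> = ennreal (palm x s' + mass * (\<beta> * (s' - s) * palm x s))"
    using assms palm_nonneg[of s x] palm_nonneg[of s' x] mass_nonneg beta_pos
    by (intro ennreal_plus[symmetric]) auto
  finally have "palm x s \<le> palm x s' + mass * (\<beta> * (s' - s) * palm x s)"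
    using assms palm_nonneg[of s x] palm_nonneg[of s' x] mass_nonneg beta_pos
    by (subst (asm) ennreal_le_iff) auto
  then show ?thesis by (simp add: algebra_simps)
qed

text \<open>The discrete form of \<open>\<Psi>' = - \<integral>u x * palm x s dx\<close>. The lower product bound puts the later
  time \<open>s'\<close> into the sum, which gives the inequality the direction needed for an upper bound
  on \<open>\<Psi>\<close>.\<close>

lemma Psi_step:
  assumes "0 \<le> s" "s \<le> s'" "s' \<le> 1" and "0 \<le> p" "\<And>x. p \<le> palm x s'"
  shows "\<Psi> s' + (s' - s) * mass * p \<le> \<Psi> s"
proof -
  define f where "f = (\<lambda>\<xi>. (s' - s) * thin s' \<xi>)"
  have f [measurable]: "f \<in> borel_measurable config_space" unfolding f_def by measurable
  have f_nonneg: "0 \<le> f \<xi>" for \<xi>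
    unfolding f_def using assms thin_nonneg by simp
  have "ennreal (mass * ((s' - s) * p)) = (\<integral>\<^sup>+x. ennreal (u x) * ennreal ((s' - s) * p) \<partial>lborel)"
    by (simp only: nn_integral_u_mult)
  also have "\<dots> \<le> (\<integral>\<^sup>+x. ennreal (u x) * (\<integral>\<^sup>+\<omega>. ennreal (ci x (\<Xi> \<omega>) * f (\<Xi> \<omega>)) \<partial>M) \<partial>lborel)"
  proof (intro nn_integral_mono mult_left_mono)
    fix x
    have "ennreal ((s' - s) * p) \<le> ennreal ((s' - s) * palm x s')"
      using assms by (intro ennreal_leI mult_left_mono) auto
    also have "\<dots> = (\<integral>\<^sup>+\<omega>. ennreal (s' - s) * ennreal (ci x (\<Xi> \<omega>) * thin s' (\<Xi> \<omega>)) \<partial>M)"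
      using assms by (subst nn_integral_cmult) (simp_all add: nn_palm ennreal_mult')
    also have "\<dots> = (\<integral>\<^sup>+\<omega>. ennreal (ci x (\<Xi> \<omega>) * f (\<Xi> \<omega>)) \<partial>M)"
      using assms by (simp add: f_def ac_simps flip: ennreal_mult')
    finally show "ennreal ((s' - s) * p) \<le> (\<integral>\<^sup>+\<omega>. ennreal (ci x (\<Xi> \<omega>) * f (\<Xi> \<omega>)) \<partial>M)" .
  qed simp
  also have "\<dots> = (\<integral>\<^sup>+\<omega>. (\<integral>\<^sup>+z. ennreal (u z * f (\<Xi> \<omega> - {z})) \<partial>count_space (\<Xi> \<omega>)) \<partial>M)"
    by (intro gnz_u[symmetric] f_nonneg f)
  finally have "ennreal (\<Psi> s') + ennreal (mass * ((s' - s) * p))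
      \<le> (\<integral>\<^sup>+\<omega>. ennreal (thin s' (\<Xi> \<omega>)) \<partial>M)
        + (\<integral>\<^sup>+\<omega>. (\<integral>\<^sup>+z. ennreal (u z * f (\<Xi> \<omega> - {z})) \<partial>count_space (\<Xi> \<omega>)) \<partial>M)"
    using assms by (simp only: nn_Psi) (intro add_left_mono, simp add: nn_Psi)
  also have "\<dots> \<le> (\<integral>\<^sup>+\<omega>. ennreal (thin s (\<Xi> \<omega>)) \<partial>M)"
  proof (intro nn_integral_add_le_nonmeasurable)
    fix \<omega> assume "\<omega> \<in> space M"
    note c = Xi_config[OF this]
    have "ennreal (thin s' (\<Xi> \<omega>)) + ennreal (\<Sum>z\<in>\<Xi> \<omega> \<inter> W. u z * f (\<Xi> \<omega> - {z}))
        = ennreal (thin s' (\<Xi> \<omega>) + (\<Sum>z\<in>\<Xi> \<omega> \<inter> W. u z * f (\<Xi> \<omega> - {z})))"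
      using assms u_nonneg f_nonneg thin_nonneg
      by (intro ennreal_plus[symmetric] sum_nonneg mult_nonneg_nonneg) auto
    also have "\<dots> \<le> ennreal (thin s (\<Xi> \<omega>))"
      unfolding f_def using c assms by (intro ennreal_leI thin_lower)
    finally show "ennreal (thin s' (\<Xi> \<omega>))
        + (\<integral>\<^sup>+z. ennreal (u z * f (\<Xi> \<omega> - {z})) \<partial>count_space (\<Xi> \<omega>)) \<le> ennreal (thin s (\<Xi> \<omega>))"
      using count_space_sum[OF c, of f] f_nonneg by presburger
  qed auto
  finally have "ennreal (\<Psi> s') + ennreal (mass * ((s' - s) * p)) \<le> ennreal (\<Psi> s)"
    using assms by (simp add: nn_Psi)
  moreover have "ennreal (\<Psi> s') + ennreal (mass * ((s' - s) * p)) = ennreal (\<Psi> s' + mass * ((s' - s) * p))"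
    using assms Psi_nonneg mass_nonneg by (intro ennreal_plus[symmetric]) auto
  ultimately have "\<Psi> s' + mass * ((s' - s) * p) \<le> \<Psi> s"
    using assms Psi_nonneg[of s] by (simp add: ennreal_le_iff)
  then show ?thesis by (simp add: ac_simps)
qed

text \<open>With \<open>n\<close> equal steps, \<open>q = 1 - \<beta> mass / n\<close> is the loss factor of \<open>palm x\<close> per step, so that
  \<open>palm x (k / n) \<ge> l q^k\<close>, and the decrements of \<open>\<Psi>\<close> add up to a geometric sum.\<close>

lemma Psi_le: "\<Psi> 1 \<le> 1 - l / \<beta> * (1 - exp (- \<beta> * mass))"
proof -
  define c where "c = \<beta> * mass"
  have c: "0 \<le> c" using beta_pos mass_nonneg by (simp add: c_def)
  have main: "\<Psi> 1 \<le> 1 - l / \<beta> * ((1 - c / n) * (1 - (1 - c / n) ^ n))" if n: "0 < n" "c \<le> real n" for n :: nat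
  proof -
    define q where "q = 1 - c / n"
    have q: "0 \<le> q" using n by (simp add: q_def)
    have palm: "l * q ^ k \<le> palm x (k / n)" if "k \<le> n" for k x
      using that
    proof (induction k)
      case (Suc k)
      have q_eq: "q = 1 - (Suc k / n - k / n) * (\<beta> * mass)"
        using n by (simp add: q_def c_def field_simps)
      have "l * q ^ Suc k \<le> q * palm x (k / n)"
        using mult_left_mono[OF Suc.IH q] Suc.prems by (simp add: ac_simps)
      also have "q * palm x (k / n) \<le> palm x (Suc k / n)"
        unfolding q_eq using Suc.prems n by (intro palm_step) (auto simp: divide_simps)
      finally show ?case .
    qed (simp add: palm_0)
    have "\<Psi> (k / n) \<le> 1 - l / \<beta> * (q * (1 - q ^ k))" if "k \<le> n" for k
      using that
    proof (induction k)
      case (Suc k)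
      have "\<Psi> (Suc k / n) + (Suc k / n - k / n) * mass * (l * q ^ Suc k) \<le> \<Psi> (k / n)"
        using Suc.prems n l_nonneg q palm[of "Suc k"]
        by (intro Psi_step) (auto simp: divide_simps)
      moreover have "(Suc k / n - k / n) * mass = (1 - q) / \<beta>"
        using n beta_pos by (simp add: q_def c_def field_simps)
      ultimately have "\<Psi> (Suc k / n) \<le> 1 - l / \<beta> * (q * (1 - q ^ k)) - (1 - q) / \<beta> * (l * q ^ Suc k)"
        using Suc by simp
      also have "\<dots> = 1 - l / \<beta> * (q * (1 - q ^ Suc k))"
        using beta_pos by (simp add: field_simps)
      finally show ?case .
    qed (simp add: Psi_0)
    from this[of n] show ?thesis using n by (simp add: q_def)
  qed
  have "(\<lambda>n. 1 - l / \<beta> * ((1 - c / real n) * (1 - (1 - c / real n) ^ n)))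
      \<longlonglongrightarrow> 1 - l / \<beta> * ((1 - 0) * (1 - exp (- c)))"
    using tendsto_exp_limit_sequentially[of "- c"]
    by (intro tendsto_intros lim_const_over_n) simp
  moreover have "\<forall>\<^sub>F n in sequentially. \<Psi> 1 \<le> 1 - l / \<beta> * ((1 - c / real n) * (1 - (1 - c / real n) ^ n))"
    using eventually_gt_at_top[of 0] eventually_ge_at_top[of "nat \<lceil>c\<rceil>"]
    by eventually_elim (rule main, auto simp: nat_ceiling_le_eq)
  ultimately show ?thesis
    using tendsto_lowerbound[of _ _ sequentially "\<Psi> 1"] by (simp add: c_def)
qed

end

section \<open>Pairwise interaction processes\<close>

lemma pip_intensity_eq:
  assumes "finite F" "F \<subseteq> \<xi>" "\<And>y. y \<in> \<xi> - F \<Longrightarrow> \<phi> (x - y) = 1"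
  shows "pip_intensity \<beta> \<phi> x \<xi> = \<beta> * (\<Prod>y\<in>F. \<phi> (x - y))"
  unfolding pip_intensity_def using assms by (subst infprod_on_eq_prod[of F]) auto

lemma pip_intensity_translate:
  assumes "finite {y \<in> \<xi>. \<phi> (- y) \<noteq> 1}"
  shows "pip_intensity \<beta> \<phi> x ((\<lambda>y. x + y) ` \<xi>) = pip_intensity \<beta> \<phi> 0 \<xi>"
proof -
  let ?F = "{y \<in> \<xi>. \<phi> (- y) \<noteq> 1}"
  have "pip_intensity \<beta> \<phi> x ((\<lambda>y. x + y) ` \<xi>) = \<beta> * (\<Prod>y\<in>(\<lambda>y. x + y) ` ?F. \<phi> (x - y))"
    using assms by (intro pip_intensity_eq) auto
  also have "\<dots> = \<beta> * (\<Prod>y\<in>?F. \<phi> (0 - y))"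
    by (subst prod.reindex) (auto simp: inj_on_def)
  also have "\<dots> = pip_intensity \<beta> \<phi> 0 \<xi>"
    using assms by (intro pip_intensity_eq[symmetric]) auto
  finally show ?thesis .
qed

lemma finite_range_bound:
  assumes "finite_range \<phi>"
  obtains R where "\<And>x. R < norm x \<Longrightarrow> \<phi> x = 1"
proof -
  have "bounded {x. 1 - \<phi> x \<noteq> 0}"
    using assms unfolding finite_range_def
    by (meson bounded_subset closure_subset compact_imp_bounded)
  then obtain R where "\<forall>x\<in>{x. 1 - \<phi> x \<noteq> 0}. norm x \<le> R"
    unfolding bounded_iff by blast
  then have "\<phi> x = 1" if "R < norm x" for x using that by force
  then show thesis by (rule that)
qed

lemma finite_interacting:
  fixes x :: "'a::euclidean_space"
  assumes "\<xi> \<in> configs" "\<And>x. R < norm x \<Longrightarrow> \<phi> x = 1"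
  shows "finite {y \<in> \<xi>. \<phi> (x - y) \<noteq> 1}"
proof (rule finite_subset)
  show "{y \<in> \<xi>. \<phi> (x - y) \<noteq> 1} \<subseteq> \<xi> \<inter> cball x R"
    using assms(2) by (force simp: dist_norm not_less)
  show "finite (\<xi> \<inter> cball x R)" using assms(1) by (simp add: finite_config_Int)
qed

lemma stationary_nn_integral:
  fixes \<Xi> :: "'w \<Rightarrow> 'a::euclidean_space set"
  assumes "stationary M \<Xi>" and [measurable]: "\<Xi> \<in> measurable M config_space"
    "f \<in> borel_measurable config_space"
  shows "(\<integral>\<^sup>+\<omega>. f ((\<lambda>y. a + y) ` \<Xi> \<omega>) \<partial>M) = (\<integral>\<^sup>+\<omega>. f (\<Xi> \<omega>) \<partial>M)"
proof -
  have [measurable]: "(\<lambda>\<omega>. (\<lambda>y. a + y) ` \<Xi> \<omega>) \<in> measurable M config_space"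
    by (rule measurable_compose[OF assms(2) measurable_config_translate])
  have "(\<integral>\<^sup>+\<omega>. f ((\<lambda>y. a + y) ` \<Xi> \<omega>) \<partial>M)
      = (\<integral>\<^sup>+\<xi>. f \<xi> \<partial>distr M config_space (\<lambda>\<omega>. (\<lambda>y. a + y) ` \<Xi> \<omega>))"
    by (rule nn_integral_distr[symmetric]) measurable
  also have "\<dots> = (\<integral>\<^sup>+\<xi>. f \<xi> \<partial>distr M config_space \<Xi>)"
    using assms(1) by (simp add: stationary_def)
  also have "\<dots> = (\<integral>\<^sup>+\<omega>. f (\<Xi> \<omega>) \<partial>M)"
    by (rule nn_integral_distr) measurable
  finally show ?thesis .
qed

text \<open>A factor \<open>\<phi> (x - z) \<le> 1\<close> can only lower the product, which gives the bound by \<open>\<beta>\<close> and the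
  monotonicity; stationarity makes the mean independent of the location.\<close>

lemma repulsive_gibbs_PIP:
  assumes pip: "PIP M \<Xi> \<beta> \<phi>" and inh: "inhibitory \<phi>" and range: "finite_range \<phi>"
  shows "repulsive_gibbs M \<Xi> (pip_intensity \<beta> \<phi>) \<beta> (intensity M \<Xi> (pip_intensity \<beta> \<phi>))"
proof -
  obtain R where R: "\<And>x. R < norm x \<Longrightarrow> \<phi> x = 1"
    using finite_range_bound[OF range] by blast
  let ?ci = "pip_intensity \<beta> \<phi>"
  have beta: "0 < \<beta>" and phi: "\<And>x. 0 \<le> \<phi> x" "\<And>x. \<phi> x \<le> 1" and stat: "stationary M \<Xi>"
    and gibbs: "gibbs_process M \<Xi> ?ci"
    using pip inh by (auto simp: PIP_def inhibitory_def)
  have Xi: "\<Xi> \<in> measurable M config_space"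
    and ci2: "(\<lambda>(x, \<xi>). ?ci x \<xi>) \<in> borel_measurable (borel \<Otimes>\<^sub>M config_space)"
    and ci_nonneg: "\<And>x \<xi>. \<xi> \<in> configs \<Longrightarrow> 0 \<le> ?ci x \<xi>"
    using gibbs by (auto simp: gibbs_process_def point_process_def)
  have ci: "?ci x \<in> borel_measurable config_space" for x
    using measurable_compose[OF measurable_Pair1'[of x borel config_space] ci2] by simp
  have eq: "?ci x \<xi> = \<beta> * (\<Prod>y | y \<in> \<xi> \<and> \<phi> (x - y) \<noteq> 1. \<phi> (x - y))" if "\<xi> \<in> configs" for x \<xi>
    using finite_interacting[where \<phi> = \<phi>, OF that R] by (intro pip_intensity_eq) auto
  show ?thesis
  proof
    show "?ci x \<xi> \<le> \<beta>" if "\<xi> \<in> configs" for x \<xi>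
      using eq[OF that] beta phi by (simp add: prod_le_1)
    show "?ci x \<xi> \<le> ?ci x (\<xi> - {z})" if "\<xi> \<in> configs" for x \<xi> z
    proof -
      let ?F = "{y \<in> \<xi>. \<phi> (x - y) \<noteq> 1}"
      have F: "finite ?F" using finite_interacting[where \<phi> = \<phi>, OF that R] by blast
      have "(\<Prod>y\<in>?F. \<phi> (x - y)) \<le> (\<Prod>y\<in>?F - {z}. \<phi> (x - y))"
        using prod.remove[OF F, of z "\<lambda>y. \<phi> (x - y)"] phi
        by (cases "z \<in> ?F") (auto intro!: mult_left_le_one_le prod_nonneg)
      also have "?F - {z} = {y \<in> \<xi> - {z}. \<phi> (x - y) \<noteq> 1}" by auto
      finally have "(\<Prod>y\<in>?F. \<phi> (x - y)) \<le> (\<Prod>y | y \<in> \<xi> - {z} \<and> \<phi> (x - y) \<noteq> 1. \<phi> (x - y))" .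
      then show ?thesis
        unfolding eq[OF that] eq[OF config_Diff[OF that]] using beta by (intro mult_left_mono) auto
    qed
    show "(\<integral>\<omega>. ?ci x (\<Xi> \<omega>) \<partial>M) = intensity M \<Xi> ?ci" for x
    proof -
      have c: "\<Xi> \<omega> \<in> configs" if "\<omega> \<in> space M" for \<omega>
        using measurable_space[OF Xi that] by simp
      have "(\<integral>\<^sup>+\<omega>. ennreal (?ci x (\<Xi> \<omega>)) \<partial>M) = (\<integral>\<^sup>+\<omega>. ennreal (?ci x ((\<lambda>y. x + y) ` \<Xi> \<omega>)) \<partial>M)"
        using stat Xi ci by (intro stationary_nn_integral[symmetric]) auto
      also have "\<dots> = (\<integral>\<^sup>+\<omega>. ennreal (?ci 0 (\<Xi> \<omega>)) \<partial>M)"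
        using finite_interacting[where \<phi> = \<phi> and x = 0, OF c R]
        by (intro nn_integral_cong) (simp add: pip_intensity_translate)
      finally have "(\<integral>\<^sup>+\<omega>. ennreal (?ci x (\<Xi> \<omega>)) \<partial>M) = (\<integral>\<^sup>+\<omega>. ennreal (?ci 0 (\<Xi> \<omega>)) \<partial>M)" .
      moreover have "(\<integral>\<omega>. ?ci y (\<Xi> \<omega>) \<partial>M) = enn2real (\<integral>\<^sup>+\<omega>. ennreal (?ci y (\<Xi> \<omega>)) \<partial>M)" for y
        using measurable_compose[OF Xi ci] c ci_nonneg by (intro integral_eq_nn_integral) auto
      ultimately show ?thesis by (simp add: intensity_def)
    qed
  qed (fact gibbs beta)+
qed

theorem mainTheorem4:
  fixes M :: "'w measure"
    and \<Xi> :: "'w \<Rightarrow> 'a::euclidean_space set"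
    and \<beta> lam t :: real
    and \<phi> :: "'a \<Rightarrow> real"
    and B :: "'a set"
  assumes "PIP M \<Xi> \<beta> \<phi>"
    and "inhibitory \<phi>"
    and "finite_range \<phi>"
    and "lam = intensity M \<Xi> (pip_intensity \<beta> \<phi>)"
    and "B \<in> sets borel" and "0 < emeasure lborel B" and "emeasure lborel B < \<infinity>"
    and "t \<ge> 0"
  shows "2 - \<beta> / lam - exp (- \<beta> * G_tilde \<phi> t) \<le> nn_function M \<Xi> lam B t
       \<and> nn_function M \<Xi> lam B t \<le> 1 - \<beta> / lam + \<beta> * G_tilde \<phi> t"
proof -
  let ?ci = "pip_intensity \<beta> \<phi>"
  interpret repulsive_gibbs M \<Xi> ?ci \<beta> lam
    using repulsive_gibbs_PIP assms(1-4) by simp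
  have stat: "stationary M \<Xi>" and phi_meas [measurable]: "\<phi> \<in> borel_measurable borel"
    and phi: "\<And>x. 0 \<le> \<phi> x" "\<And>x. \<phi> x \<le> 1" "\<And>x. \<phi> (- x) = \<phi> x"
    using assms(1,2) by (auto simp: PIP_def inhibitory_def)
  obtain R where R: "\<And>x. R < norm x \<Longrightarrow> \<phi> x = 1"
    using finite_range_bound[OF assms(3)] by blast
  define u where "u = (\<lambda>x::'a. 1 - \<phi> x * of_bool (norm x > t))"
  define W where "W = cball (0::'a) (max R t)"
  interpret repulsive_gibbs_window M \<Xi> ?ci \<beta> lam u W
  proof
    show "u \<in> borel_measurable borel" unfolding u_def by measurable
    show "0 \<le> u x" "u x \<le> 1" for x using phi by (auto simp: u_def)
    show "u x = 0" if "x \<notin> W" for x using that R by (auto simp: u_def W_def not_le)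
  qed (auto simp: W_def)
  have mass: "mass = G_tilde \<phi> t"
    by (simp add: u_def G_tilde_def)

  define hit where "hit = (\<lambda>p. of_bool (snd p \<inter> cball (fst p) t \<noteq> ({}::'a set)) :: real)"
  have hit_meas [measurable]: "hit \<in> borel_measurable (borel \<Otimes>\<^sub>M config_space)"
  proof -
    have [measurable]: "Measurable.pred (borel \<Otimes>\<^sub>M config_space) (\<lambda>p. snd p \<inter> cball (fst p) t = ({}::'a set))"
      using measurable_empty_ball[of t] by (simp add: case_prod_unfold)
    show ?thesis unfolding hit_def of_bool_def by measurable
  qed
  have hit_meas1 [measurable]: "(\<lambda>\<xi>. hit (x, \<xi>)) \<in> borel_measurable config_space" for x
    using measurable_compose[OF measurable_Pair1'[of x borel config_space] hit_meas] by simp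
  have hit_bounds: "0 \<le> hit p" "hit p \<le> 1" for p by (auto simp: hit_def)

  \<comment> \<open>The factors \<open>1 - u y\<close> of \<open>thin 1\<close> agree with \<open>\<phi> y\<close> for \<open>y\<close> outside the ball around the
    origin, while a point in the ball contributes a factor 0.\<close>
  have ci_hit: "?ci 0 \<xi> * hit (0, \<xi>) = ?ci 0 \<xi> - \<beta> * thin 1 \<xi>" if c: "\<xi> \<in> configs" for \<xi>
  proof -
    let ?F = "\<xi> \<inter> W"
    have F: "finite ?F" using c by (simp add: finite_config_Int W_def)
    have ci: "?ci 0 \<xi> = \<beta> * (\<Prod>y\<in>?F. \<phi> (0 - y))"
      using F R by (intro pip_intensity_eq) (auto simp: W_def not_le)
    show ?thesis
    proof (cases "\<xi> \<inter> cball 0 t = {}")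
      case True
      then have "norm y > t" if "y \<in> ?F" for y using that by (auto simp: not_le[symmetric])
      then have "thin 1 \<xi> = (\<Prod>y\<in>?F. \<phi> (0 - y))"
        unfolding thin_def by (intro prod.cong) (auto simp: u_def phi)
      with True show ?thesis by (simp add: hit_def ci)
    next
      case False
      then obtain y where "y \<in> \<xi>" "norm y \<le> t" by auto
      then have "y \<in> ?F" "1 - 1 * u y = 0" by (auto simp: W_def u_def)
      then have "thin 1 \<xi> = 0" unfolding thin_def using F by (intro prod_zero) auto
      with False show ?thesis by (simp add: hit_def)
    qed
  qed
  have hit_translate: "hit (x, (\<lambda>y. x + y) ` \<xi>) = hit (0, \<xi>)" for x \<xi>
  proof -
    have "(\<lambda>y. x + y) ` \<xi> \<inter> cball x t = (\<lambda>y. x + y) ` (\<xi> \<inter> cball 0 t)"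
      by (auto simp: dist_norm)
    then show ?thesis by (simp add: hit_def)
  qed
  have ci_hit_bounds: "0 \<le> ?ci x \<xi> * hit (x, \<xi>)" "?ci x \<xi> * hit (x, \<xi>) \<le> \<beta>"
    if "\<xi> \<in> configs" for x \<xi>
    using ci_nonneg[OF that] ci_le[OF that] beta_pos by (auto simp: hit_def)

  have E0: "(\<integral>\<omega>. ?ci 0 (\<Xi> \<omega>) * hit (0, \<Xi> \<omega>) \<partial>M) = lam - \<beta> * \<Psi> 1"
  proof -
    have "(\<integral>\<omega>. ?ci 0 (\<Xi> \<omega>) * hit (0, \<Xi> \<omega>) \<partial>M) = (\<integral>\<omega>. ?ci 0 (\<Xi> \<omega>) - \<beta> * thin 1 (\<Xi> \<omega>) \<partial>M)"
      using ci_hit Xi_config by (intro Bochner_Integration.integral_cong) auto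
    also have "\<dots> = (\<integral>\<omega>. ?ci 0 (\<Xi> \<omega>) \<partial>M) - (\<integral>\<omega>. \<beta> * thin 1 (\<Xi> \<omega>) \<partial>M)"
    proof (rule Bochner_Integration.integral_diff)
      show "integrable M (\<lambda>\<omega>. ?ci 0 (\<Xi> \<omega>))"
        by (rule integrable_Xi[where b = \<beta>]) (auto simp: ci_nonneg ci_le)
      have "integrable M (\<lambda>\<omega>. thin 1 (\<Xi> \<omega>))"
        by (rule integrable_Xi[where b = 1]) (auto simp: thin_nonneg thin_le_1)
      then show "integrable M (\<lambda>\<omega>. \<beta> * thin 1 (\<Xi> \<omega>))" by simp
    qed
    finally show ?thesis by (simp add: mean_ci \<Psi>_def)
  qed
  then have E0_nonneg: "0 \<le> lam - \<beta> * \<Psi> 1"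
    using ci_hit_bounds Xi_config by (metis (mono_tags, lifting) integral_nonneg_AE AE_I2)

  have E: "(\<integral>\<^sup>+\<omega>. ennreal (?ci x (\<Xi> \<omega>) * hit (x, \<Xi> \<omega>)) \<partial>M) = ennreal (lam - \<beta> * \<Psi> 1)" for x
  proof -
    have "(\<integral>\<^sup>+\<omega>. ennreal (?ci x (\<Xi> \<omega>) * hit (x, \<Xi> \<omega>)) \<partial>M)
        = (\<integral>\<^sup>+\<omega>. ennreal (?ci x ((\<lambda>y. x + y) ` \<Xi> \<omega>) * hit (x, (\<lambda>y. x + y) ` \<Xi> \<omega>)) \<partial>M)"
      using stat by (intro stationary_nn_integral[symmetric]) auto
    also have "\<dots> = (\<integral>\<^sup>+\<omega>. ennreal (?ci 0 (\<Xi> \<omega>) * hit (0, \<Xi> \<omega>)) \<partial>M)"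
      using finite_interacting[where \<phi> = \<phi> and x = 0, OF Xi_config R]
      by (intro nn_integral_cong) (simp add: pip_intensity_translate hit_translate)
    also have "\<dots> = ennreal (\<integral>\<omega>. ?ci 0 (\<Xi> \<omega>) * hit (0, \<Xi> \<omega>) \<partial>M)"
      using ci_hit_bounds by (intro nn_integral_Xi[where b = \<beta>]) auto
    finally show ?thesis by (simp only: E0)
  qed

  define b where "b = measure lborel B"
  have b: "0 < b" "emeasure lborel B = ennreal b"
    using assms(6,7) by (simp_all add: b_def measure_def enn2real_positive_iff)
  have [measurable]: "B \<in> sets borel" by fact
  have "(\<integral>\<^sup>+\<omega>. (\<integral>\<^sup>+x. of_bool (\<exists>y\<in>\<Xi> \<omega> - {x}. norm (y - x) \<le> t) \<partial>count_space (\<Xi> \<omega> \<inter> B)) \<partial>M)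
      = (\<integral>\<^sup>+\<omega>. (\<integral>\<^sup>+x. ennreal (indicator B x * hit (x, \<Xi> \<omega> - {x})) \<partial>count_space (\<Xi> \<omega>)) \<partial>M)"
  proof (intro nn_integral_cong)
    fix \<omega>
    have "(\<integral>\<^sup>+x. of_bool (\<exists>y\<in>\<Xi> \<omega> - {x}. norm (y - x) \<le> t) \<partial>count_space (\<Xi> \<omega> \<inter> B))
        = (\<integral>\<^sup>+x. of_bool (\<exists>y\<in>\<Xi> \<omega> - {x}. norm (y - x) \<le> t) * indicator B x \<partial>count_space (\<Xi> \<omega>))"
      by (simp add: nn_integral_count_space_indicator indicator_inter_arith ac_simps)
    also have "\<dots> = (\<integral>\<^sup>+x. ennreal (indicator B x * hit (x, \<Xi> \<omega> - {x})) \<partial>count_space (\<Xi> \<omega>))"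
    proof (intro nn_integral_cong)
      fix x
      have "(\<exists>y\<in>\<Xi> \<omega> - {x}. norm (y - x) \<le> t) \<longleftrightarrow> (\<Xi> \<omega> - {x}) \<inter> cball x t \<noteq> {}"
        by (auto simp: dist_norm norm_minus_commute)
      then show "of_bool (\<exists>y\<in>\<Xi> \<omega> - {x}. norm (y - x) \<le> t) * indicator B x
          = ennreal (indicator B x * hit (x, \<Xi> \<omega> - {x}))"
        by (simp add: hit_def indicator_def)
    qed
    finally show "(\<integral>\<^sup>+x. of_bool (\<exists>y\<in>\<Xi> \<omega> - {x}. norm (y - x) \<le> t) \<partial>count_space (\<Xi> \<omega> \<inter> B))
        = (\<integral>\<^sup>+x. ennreal (indicator B x * hit (x, \<Xi> \<omega> - {x})) \<partial>count_space (\<Xi> \<omega>))" .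
  qed
  also have "\<dots> = (\<integral>\<^sup>+x. (\<integral>\<^sup>+\<omega>. ennreal (indicator B x * hit (x, \<Xi> \<omega>) * ?ci x (\<Xi> \<omega>)) \<partial>M) \<partial>lborel)"
    using gnz[of "\<lambda>p. indicator B (fst p) * hit p"] hit_bounds by simp
  also have "\<dots> = (\<integral>\<^sup>+x. ennreal (lam - \<beta> * \<Psi> 1) * indicator B x \<partial>lborel)"
  proof (intro nn_integral_cong)
    fix x
    show "(\<integral>\<^sup>+\<omega>. ennreal (indicator B x * hit (x, \<Xi> \<omega>) * ?ci x (\<Xi> \<omega>)) \<partial>M)
        = ennreal (lam - \<beta> * \<Psi> 1) * indicator B x"
      using E[of x] by (cases "x \<in> B") (simp_all add: mult.commute)
  qed
  also have "\<dots> = ennreal ((lam - \<beta> * \<Psi> 1) * b)"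
    using E0_nonneg by (simp add: nn_integral_cmult_indicator b ennreal_mult')
  finally have nn: "nn_function M \<Xi> lam B t = (lam - \<beta> * \<Psi> 1) / lam"
    using E0_nonneg b by (simp add: nn_function_def flip: b_def)

  \<comment> \<open>A vanishing intensity would mean no points at all, hence no interaction and
    conditional intensity \<open>\<beta>\<close>.\<close>
  have "\<beta> * (1 - lam * mass) \<le> \<beta> * \<Psi> 1"
    using beta_pos by (intro mult_left_mono Psi_ge) simp
  then have "\<beta> * (1 - lam * mass) \<le> lam" using E0_nonneg by linarith
  then have "lam \<noteq> 0" using beta_pos by auto
  with l_nonneg have lam: "0 < lam" by simp
  have "nn_function M \<Xi> lam B t = 1 - \<beta> / lam * \<Psi> 1"
    using lam by (simp add: nn field_simps)
  moreover have "\<beta> / lam * \<Psi> 1 \<le> \<beta> / lam * (1 - lam / \<beta> * (1 - exp (- \<beta> * mass)))"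
    using lam beta_pos by (intro mult_left_mono Psi_le) simp
  moreover have "\<beta> / lam * (1 - lam / \<beta> * (1 - exp (- \<beta> * mass)))
      = \<beta> / lam - 1 + exp (- \<beta> * mass)"
    using lam beta_pos by (simp add: field_simps)
  moreover have "\<beta> / lam * (1 - lam * mass) \<le> \<beta> / lam * \<Psi> 1"
    using lam beta_pos by (intro mult_left_mono Psi_ge) simp
  moreover have "\<beta> / lam * (1 - lam * mass) = \<beta> / lam - \<beta> * mass"
    using lam by (simp add: field_simps)
  ultimately show ?thesis
    unfolding mass[symmetric] by linarith
qed

end
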